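(* Let $\mathfrak{g}=A_{5,5}$ and let $\langle\cdot,\cdot\rangle$ be an inner product on $\mathfrak{g}$. Let $\eta>0$ and let $\{v_1,\dots,v_5\}$ be a basis of $\mathfrak{g}$, orthonormal with respect to $\eta\langle\cdot,\cdot\rangle$, whose only nonzero brackets (up to antisymmetry) are $[v_1,v_2]=\alpha v_4+\beta v_5$, $[v_1,v_3]=\gamma v_5$, $[v_2,v_3]=\delta v_5$, $[v_2,v_4]=\varepsilon v_5$, with $\alpha,\gamma,\varepsilon>0$ and $\beta,\delta\in\mathbb{R}$. Then $\langle\cdot,\cdot\rangle$ is a Schouten like metric if and only if $\beta=\delta=0$ and $\alpha=\varepsilon=\sqrt{2}\,\gamma$.
   Context: $A_{5,5}$ is the five-dimensional real nilpotent Lie algebra having a basis with the brackets displayed in the claim. An inner product on $\mathfrak{g}$ is identified with the left-invariant Riemannian metric $g$ it induces on the simply connected Lie group $G$ with Lie algebra $\mathfrak{g}$. Let $ric_g$ be the Ricci curvature tensor of $(G,g)$ (Levi-Civita connection), viewed as a symmetric bilinear form on $\mathfrak{g}$; since $\mathfrak{g}$ is nilpotent, $ric_g(u,v)=-\frac12\mathrm{tr}(ad_u\circ ad_v^* )-\frac14\mathrm{tr}(J_u\circ J_v)$, where $ad_uv=[u,v]$, $ad_v^*$ is the $g$-transpose of $ad_v$, and $J_uv=ad_v^*u$. The Ricci operator $Ric_g$ is defined by $ric_g(u,v)=g(Ric_g(u),v)$ and $s=\mathrm{tr}(Ric_g)$ is the scalar curvature. A derivation $D$ of $\mathfrak{g}$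 is symmetric with respect to $g$ if $g(Du,v)=g(u,Dv)$ for all $u,v$. The metric $g$ is a Schouten like metric if there are real numbers $\lambda_0,c$ and a derivation $D$ of $\mathfrak{g}$, symmetric with respect to $g$, such that $ric_g(X,Y)=(s\lambda_0+c)g(X,Y)+g(D(X),Y)$ for all $X,Y\in\mathfrak{g}$. *)

theory Defs
  imports "HOL-Analysis.Analysis"
begin

section \<open>Lie algebras, inner products and traces\<close>

definition lie_bracket :: "('a::real_vector \<Rightarrow> 'a \<Rightarrow> 'a) \<Rightarrow> bool" where
  "lie_bracket br \<longleftrightarrow> bilinear br \<and> (\<forall>x. br x x = 0) \<and>
     (\<forall>x y z. br x (br y z) + br y (br z x) + br z (br x y) = 0)"

definition inner_product :: "('a::real_vector \<Rightarrow> 'a \<Rightarrow> real) \<Rightarrow> bool" where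
  "inner_product g \<longleftrightarrow> bilinear g \<and> (\<forall>x y. g x y = g y x) \<and> (\<forall>x. x \<noteq> 0 \<longrightarrow> 0 < g x x)"

text \<open>The trace of an endomorphism of a finite-dimensional space, read off in some basis;
  the choice of the basis is irrelevant by \<open>endo_trace_basis\<close> below.\<close>

definition endo_trace :: "('a::real_vector \<Rightarrow> 'a) \<Rightarrow> real" where
  "endo_trace f =
     (let B = (SOME B. finite B \<and> independent B \<and> span B = UNIV)
      in \<Sum>b\<in>B. representation B (f b) b)"


section \<open>Curvature of a left-invariant metric\<close>

text \<open>Left-invariant vector fields on the simply connected Lie group of a Lie algebra are
  identified with elements of the Lie algebra. If \<open>Y\<close> and \<open>Z\<close> are left-invariant then
  \<open>g Y Z\<close> is a constant function, so its derivative \<open>X (g Y Z)\<close> vanishes in the condition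
  that the connection is metric.\<close>

definition levi_civita_connection ::
    "('a::real_vector \<Rightarrow> 'a \<Rightarrow> 'a) \<Rightarrow> ('a \<Rightarrow> 'a \<Rightarrow> real) \<Rightarrow> ('a \<Rightarrow> 'a \<Rightarrow> 'a) \<Rightarrow> bool" where
  "levi_civita_connection br g N \<longleftrightarrow> bilinear N \<and>
     (\<forall>x y. N x y - N y x = br x y) \<and>
     (\<forall>x y z. g (N x y) z + g y (N x z) = 0)"

definition levi_civita ::
    "('a::real_vector \<Rightarrow> 'a \<Rightarrow> 'a) \<Rightarrow> ('a \<Rightarrow> 'a \<Rightarrow> real) \<Rightarrow> 'a \<Rightarrow> 'a \<Rightarrow> 'a" where
  "levi_civita br g = (THE N. levi_civita_connection br g N)"

definition curvature ::
    "('a::real_vector \<Rightarrow> 'a \<Rightarrow> 'a) \<Rightarrow> ('a \<Rightarrow> 'a \<Rightarrow> real) \<Rightarrow> 'a \<Rightarrow> 'a \<Rightarrow> 'a \<Rightarrow> 'a" where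
  "curvature br g x y z =
     levi_civita br g x (levi_civita br g y z) - levi_civita br g y (levi_civita br g x z)
       - levi_civita br g (br x y) z"

definition ricci ::
    "('a::real_vector \<Rightarrow> 'a \<Rightarrow> 'a) \<Rightarrow> ('a \<Rightarrow> 'a \<Rightarrow> real) \<Rightarrow> 'a \<Rightarrow> 'a \<Rightarrow> real" where
  "ricci br g u v = endo_trace (\<lambda>w. curvature br g w u v)"

definition ricci_operator ::
    "('a::real_vector \<Rightarrow> 'a \<Rightarrow> 'a) \<Rightarrow> ('a \<Rightarrow> 'a \<Rightarrow> real) \<Rightarrow> 'a \<Rightarrow> 'a" where
  "ricci_operator br g u = (THE w. \<forall>v. ricci br g u v = g w v)"

definition scalar_curvature ::
    "('a::real_vector \<Rightarrow> 'a \<Rightarrow> 'a) \<Rightarrow> ('a \<Rightarrow> 'a \<Rightarrow> real) \<Rightarrow> real" where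
  "scalar_curvature br g = endo_trace (ricci_operator br g)"


section \<open>Schouten like metrics\<close>

definition lie_derivation :: "('a::real_vector \<Rightarrow> 'a \<Rightarrow> 'a) \<Rightarrow> ('a \<Rightarrow> 'a) \<Rightarrow> bool" where
  "lie_derivation br D \<longleftrightarrow> linear D \<and> (\<forall>x y. D (br x y) = br (D x) y + br x (D y))"

definition schouten_like ::
    "('a::real_vector \<Rightarrow> 'a \<Rightarrow> 'a) \<Rightarrow> ('a \<Rightarrow> 'a \<Rightarrow> real) \<Rightarrow> bool" where
  "schouten_like br g \<longleftrightarrow>
     (\<exists>l0 c D. lie_derivation br D \<and> (\<forall>u v. g (D u) v = g u (D v)) \<and>
        (\<forall>x y. ricci br g x y = (scalar_curvature br g * l0 + c) * g x y + g (D x) y))"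


section \<open>The Lie algebra \<open>A\<^sub>5\<^sub>,\<^sub>5\<close>\<close>

text \<open>Bases are families indexed by \<open>1, \<dots>, 5\<close>; the values elsewhere are irrelevant.\<close>

definition basis5 :: "(nat \<Rightarrow> 'a::real_vector) \<Rightarrow> bool" where
  "basis5 v \<longleftrightarrow> inj_on v {1..5} \<and> independent (v ` {1..5}) \<and> span (v ` {1..5}) = UNIV"

definition A55_brackets ::
    "('a::real_vector \<Rightarrow> 'a \<Rightarrow> 'a) \<Rightarrow> (nat \<Rightarrow> 'a) \<Rightarrow> real \<Rightarrow> real \<Rightarrow> real \<Rightarrow> real \<Rightarrow> real \<Rightarrow> bool" where
  "A55_brackets br v \<alpha> \<beta> \<gamma> \<delta> \<epsilon> \<longleftrightarrow>
     br (v 1) (v 2) = \<alpha> *\<^sub>R v 4 + \<beta> *\<^sub>R v 5 \<and>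
     br (v 1) (v 3) = \<gamma> *\<^sub>R v 5 \<and>
     br (v 1) (v 4) = 0 \<and>
     br (v 1) (v 5) = 0 \<and>
     br (v 2) (v 3) = \<delta> *\<^sub>R v 5 \<and>
     br (v 2) (v 4) = \<epsilon> *\<^sub>R v 5 \<and>
     br (v 2) (v 5) = 0 \<and>
     br (v 3) (v 4) = 0 \<and>
     br (v 3) (v 5) = 0 \<and>
     br (v 4) (v 5) = 0"

text \<open>The algebra is fixed up to isomorphism by its standard structure constants
  \<open>[x\<^sub>1, x\<^sub>2] = x\<^sub>4\<close>, \<open>[x\<^sub>1, x\<^sub>3] = [x\<^sub>2, x\<^sub>4] = x\<^sub>5\<close>. Every member of the five-parameter family
  of brackets with \<open>\<alpha>\<close>, \<open>\<gamma>\<close>, \<open>\<epsilon>\<close> nonzero defines the same algebra, see \<open>is_A55I\<close> below.\<close>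

definition is_A55 :: "('a::real_vector \<Rightarrow> 'a \<Rightarrow> 'a) \<Rightarrow> bool" where
  "is_A55 br \<longleftrightarrow> lie_bracket br \<and> (\<exists>x. basis5 x \<and> A55_brackets br x 1 0 1 0 1)"


section \<open>The notions are well defined\<close>

lemma endo_trace_basis:
  fixes f :: "'a::real_vector \<Rightarrow> 'a"
  assumes f: "linear f" and B: "finite B" "independent B" "span B = UNIV"
  shows "endo_trace f = (\<Sum>b\<in>B. representation B (f b) b)"
proof -
  define C where "C = (SOME B::'a set. finite B \<and> independent B \<and> span B = UNIV)"
  have C: "finite C" "independent C" "span C = UNIV"
    using someI[of "\<lambda>B::'a set. finite B \<and> independent B \<and> span B = UNIV" B] B
    unfolding C_def by auto
  let ?R = "representation B" and ?S = "representation C"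
  have linR: "linear (\<lambda>x. ?R x b)" for b
    using real_vector.linear_representation[OF B(2,3)] by (simp add: linear_def real_scaleR_def[abs_def])
  have linS: "linear (\<lambda>x. ?S x b)" for b
    using real_vector.linear_representation[OF C(2,3)] by (simp add: linear_def real_scaleR_def[abs_def])
  have expB: "(\<Sum>b\<in>B. ?R x b *\<^sub>R b) = x" for x
    by (rule real_vector.sum_representation_eq) (use B in auto)
  have expC: "(\<Sum>c\<in>C. ?S x c *\<^sub>R c) = x" for x
    by (rule real_vector.sum_representation_eq) (use C in auto)
  have 1: "?R (f b) b = (\<Sum>c\<in>C. ?S (f b) c * ?R c b)" for b
  proof -
    have "?R (f b) b = ?R (\<Sum>c\<in>C. ?S (f b) c *\<^sub>R c) b"
      by (simp only: expC)
    also have "\<dots> = (\<Sum>c\<in>C. ?S (f b) c * ?R c b)"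
      by (simp add: linear_sum[OF linR[of b]] linear_scale[OF linR[of b]])
    finally show ?thesis .
  qed
  have 2: "?S (f c) c = (\<Sum>b\<in>B. ?S (f b) c * ?R c b)" for c
  proof -
    have "?S (f c) c = ?S (f (\<Sum>b\<in>B. ?R c b *\<^sub>R b)) c"
      by (simp only: expB)
    also have "\<dots> = (\<Sum>b\<in>B. ?S (f b) c * ?R c b)"
      by (simp add: linear_sum[OF linS[of c]] linear_scale[OF linS[of c]]
          linear_sum[OF f] linear_scale[OF f] mult.commute)
    finally show ?thesis .
  qed
  have "endo_trace f = (\<Sum>c\<in>C. ?S (f c) c)"
    by (simp add: endo_trace_def C_def Let_def)
  also have "\<dots> = (\<Sum>b\<in>B. ?R (f b) b)"
    unfolding 1 2 by (rule sum.swap)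
  finally show ?thesis .
qed

locale metric_lie_algebra =
  fixes br :: "'a::real_vector \<Rightarrow> 'a \<Rightarrow> 'a" and g :: "'a \<Rightarrow> 'a \<Rightarrow> real" and B :: "'a set"
  assumes lie: "lie_bracket br" and ip: "inner_product g"
    and finB: "finite B" and spanB: "span B = UNIV"
    and orthoB: "\<And>a b. a \<in> B \<Longrightarrow> b \<in> B \<Longrightarrow> g a b = (if a = b then 1 else 0)"
begin

lemma bilg: "bilinear g" and g_sym: "g x y = g y x" and g_pos: "x \<noteq> 0 \<Longrightarrow> 0 < g x x"
  using ip by (auto simp: inner_product_def)

lemma bilbr: "bilinear br" and br_self: "br x x = 0"
  using lie by (auto simp: lie_bracket_def)

lemma jacobi: "br x (br y z) + br y (br z x) + br z (br x y) = 0"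
  using lie by (simp add: lie_bracket_def)

lemma br_skew: "br x y = - br y x"
proof -
  have "br (x + y) (x + y) = br x y + br y x"
    by (simp add: bilinear_ladd[OF bilbr] bilinear_radd[OF bilbr] br_self[of x] br_self[of y])
  then show ?thesis by (metis br_self eq_neg_iff_add_eq_0)
qed

lemmas g_simps = bilinear_ladd[OF bilg] bilinear_radd[OF bilg] bilinear_lsub[OF bilg]
  bilinear_rsub[OF bilg] bilinear_lneg[OF bilg] bilinear_rneg[OF bilg]
  bilinear_lmul[OF bilg] bilinear_rmul[OF bilg] bilinear_lzero[OF bilg] bilinear_rzero[OF bilg]

lemmas br_simps = bilinear_ladd[OF bilbr] bilinear_radd[OF bilbr] bilinear_lsub[OF bilbr]
  bilinear_rsub[OF bilbr] bilinear_lneg[OF bilbr] bilinear_rneg[OF bilbr]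
  bilinear_lmul[OF bilbr] bilinear_rmul[OF bilbr] bilinear_lzero[OF bilbr] bilinear_rzero[OF bilbr]

lemma linear_g: "linear (g x)" "linear (\<lambda>x. g x y)"
  using bilg by (auto simp: bilinear_def)

lemma g_eqI: "(\<And>z. g x z = g y z) \<Longrightarrow> x = y"
  using g_pos[of "x - y"] by (force simp: g_simps)

lemma g_sum_left: "g (\<Sum>b\<in>A. h b) y = (\<Sum>b\<in>A. g (h b) y)"
  by (rule linear_sum[OF linear_g(2)])

lemma g_sum_right: "g y (\<Sum>b\<in>A. h b) = (\<Sum>b\<in>A. g y (h b))"
  by (rule linear_sum[OF linear_g(1)])

lemma g_comb: "b \<in> B \<Longrightarrow> g (\<Sum>a\<in>B. h a *\<^sub>R a) b = h b"
  by (simp add: g_sum_left g_simps orthoB finB if_distrib cong: if_cong)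

lemma indepB: "independent B"
proof (subst independent_explicit_finite_subsets, intro allI impI ballI)
  fix S u s assume S: "S \<subseteq> B" "finite S" and 0: "(\<Sum>v\<in>S. u v *\<^sub>R v) = 0" and s: "s \<in> S"
  have gvs: "g v s = (if v = s then 1 else 0)" if "v \<in> S" for v
    by (rule orthoB) (use S s that in auto)
  have "(\<Sum>v\<in>S. u v * g v s) = (\<Sum>v\<in>S. if v = s then u v else 0)"
    by (rule sum.cong) (simp_all add: gvs)
  then have "g (\<Sum>v\<in>S. u v *\<^sub>R v) s = u s"
    using S s by (simp add: g_sum_left g_simps)
  then show "u s = 0" by (simp add: 0 g_simps)
qed

lemma expandB: "(\<Sum>b\<in>B. g x b *\<^sub>R b) = x"
proof -
  have "(\<Sum>b\<in>B. representation B x b *\<^sub>R b) = x"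
    by (rule real_vector.sum_representation_eq) (use finB indepB spanB in auto)
  moreover from this have "representation B x b = g x b" if "b \<in> B" for b
    using g_comb[OF that, of "representation B x"] by simp
  ultimately show ?thesis by simp
qed

lemma representationB: "b \<in> B \<Longrightarrow> representation B x b = g x b"
proof -
  assume "b \<in> B"
  have "(\<Sum>b\<in>B. representation B x b *\<^sub>R b) = x"
    by (rule real_vector.sum_representation_eq) (use finB indepB spanB in auto)
  then show ?thesis using g_comb[OF \<open>b \<in> B\<close>, of "representation B x"] by simp
qed

lemma endo_trace_orthonormal: "linear f \<Longrightarrow> endo_trace f = (\<Sum>b\<in>B. g (f b) b)"
  using endo_trace_basis[OF _ finB indepB spanB] by (simp add: representationB)

lemma riesz:
  assumes "linear h"
  shows "g (\<Sum>b\<in>B. h b *\<^sub>R b) y = h y"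
proof -
  have "h y = h (\<Sum>b\<in>B. g y b *\<^sub>R b)" by (simp only: expandB)
  also have "\<dots> = (\<Sum>b\<in>B. g y b * h b)" by (simp add: linear_sum[OF assms] linear_scale[OF assms])
  finally show ?thesis by (simp add: g_sum_left g_simps g_sym[of y] mult.commute)
qed

lemma levi_civita_koszul:
  assumes "levi_civita_connection br g N"
  shows "2 * g (N x y) z = g (br x y) z - g (br y z) x + g (br z x) y"
proof -
  have t: "br u v = N u v - N v u" for u v
    using assms by (simp add: levi_civita_connection_def)
  have m: "g (N u v) w = - g (N u w) v" for u v w
    using assms unfolding levi_civita_connection_def by (metis g_sym eq_neg_iff_add_eq_0)
  show ?thesis
    unfolding t using m[of x y z] m[of y x z] m[of z x y] by (simp add: g_simps)
qed

lemma levi_civita_exists: "\<exists>N. levi_civita_connection br g N"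
proof -
  define k where "k x y z = (g (br x y) z - g (br y z) x + g (br z x) y) / 2" for x y z
  have lk: "linear (k x y)" for x y
    by (rule linearI) (simp_all add: k_def g_simps br_simps algebra_simps add_divide_distrib diff_divide_distrib)
  define N where "N x y = (\<Sum>b\<in>B. k x y b *\<^sub>R b)" for x y
  have gN: "g (N x y) z = k x y z" for x y z
    unfolding N_def by (rule riesz[OF lk])
  have "bilinear N"
    unfolding bilinear_def
    by (intro conjI allI linearI g_eqI; simp add: g_simps gN)
       (simp_all add: k_def g_simps br_simps algebra_simps add_divide_distrib diff_divide_distrib)
  moreover have "N x y - N y x = br x y" for x y
  proof (rule g_eqI)
    fix z
    have "g (br y x) z = - g (br x y) z" "g (br z y) x = - g (br y z) x" "g (br z x) y = - g (br x z) y"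
      using br_skew g_simps by metis+
    then show "g (N x y - N y x) z = g (br x y) z"
      by (simp add: g_simps gN k_def field_simps)
  qed
  moreover have "g (N x y) z + g y (N x z) = 0" for x y z
  proof -
    have "g (br y x) z = - g (br x y) z" "g (br z y) x = - g (br y z) x" "g (br z x) y = - g (br x z) y"
      using br_skew g_simps by metis+
    then show ?thesis by (simp add: g_sym[of y] gN k_def field_simps)
  qed
  ultimately show ?thesis unfolding levi_civita_connection_def by blast
qed

lemma levi_civita: "levi_civita_connection br g (levi_civita br g)"
proof -
  have "\<exists>!N. levi_civita_connection br g N"
  proof (rule ex_ex1I[OF levi_civita_exists])
    fix M N assume M: "levi_civita_connection br g M" and N: "levi_civita_connection br g N"
    show "M = N"
      by (intro ext g_eqI) (use levi_civita_koszul[OF M] levi_civita_koszul[OF N] in \<open>smt (verit)\<close>)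
  qed
  from theI'[OF this] show ?thesis unfolding levi_civita_def .
qed

lemma bilinear_levi_civita: "bilinear (levi_civita br g)"
  and levi_civita_torsion: "levi_civita br g x y - levi_civita br g y x = br x y"
  and levi_civita_metric: "g (levi_civita br g x y) z = - g y (levi_civita br g x z)"
  using levi_civita by (auto simp: levi_civita_connection_def eq_neg_iff_add_eq_0)

lemmas nabla_simps = bilinear_ladd[OF bilinear_levi_civita] bilinear_radd[OF bilinear_levi_civita]
  bilinear_lsub[OF bilinear_levi_civita] bilinear_rsub[OF bilinear_levi_civita]
  bilinear_lneg[OF bilinear_levi_civita] bilinear_rneg[OF bilinear_levi_civita]
  bilinear_lmul[OF bilinear_levi_civita] bilinear_rmul[OF bilinear_levi_civita]

lemma linear_curvature: "linear (\<lambda>w. curvature br g w u v)"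
  by (rule linearI)
     (simp_all add: curvature_def nabla_simps br_simps algebra_simps)

lemma ricci_eq_sum: "ricci br g u v = (\<Sum>b\<in>B. g (curvature br g b u v) b)"
  unfolding ricci_def by (rule endo_trace_orthonormal[OF linear_curvature])

lemma bilinear_ricci: "bilinear (ricci br g)"
  unfolding bilinear_def ricci_eq_sum
  by (intro conjI allI linearI;
      simp add: curvature_def nabla_simps br_simps g_simps sum.distrib sum_subtractf
        sum_distrib_left algebra_simps)

lemma ricci_operator: "ricci br g u v = g (ricci_operator br g u) v"
proof -
  have lin: "linear (ricci br g u)"
    using bilinear_ricci by (simp add: bilinear_def)
  have "\<exists>!w. \<forall>v. ricci br g u v = g w v"
  proof (rule ex_ex1I)
    show "\<exists>w. \<forall>v. ricci br g u v = g w v"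
      using riesz[OF lin] by metis
    show "w = w'" if "\<forall>v. ricci br g u v = g w v" "\<forall>v. ricci br g u v = g w' v" for w w'
      by (rule g_eqI) (use that in simp)
  qed
  from theI'[OF this] show ?thesis
    unfolding ricci_operator_def by blast
qed

lemma trace_commute:
  assumes "linear f" "linear h"
  shows "(\<Sum>b\<in>B. g (f (h b)) b) = (\<Sum>b\<in>B. g (h (f b)) b)"
proof -
  have *: "(\<Sum>b\<in>B. g (p (q b)) b) = (\<Sum>b\<in>B. \<Sum>c\<in>B. g (q b) c * g (p c) b)"
    if p: "linear p" for p q
  proof (rule sum.cong[OF refl])
    fix b
    have "g (p (q b)) b = g (p (\<Sum>c\<in>B. g (q b) c *\<^sub>R c)) b" by (simp only: expandB)
    also have "\<dots> = (\<Sum>c\<in>B. g (q b) c * g (p c) b)"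
      by (simp add: linear_sum[OF p] linear_scale[OF p] g_sum_left g_simps)
    finally show "g (p (q b)) b = (\<Sum>c\<in>B. g (q b) c * g (p c) b)" .
  qed
  show ?thesis
    unfolding *[OF assms(1)] *[OF assms(2)] by (subst sum.swap) (simp add: mult.commute)
qed

text \<open>For nilpotent Lie algebras the two trace conditions below hold. Here \<open>ads u\<close> is the
  transpose of \<open>ad\<^sub>u\<close>, and \<open>J\<^sub>u w = ads w u\<close>.\<close>

lemma ricci_nilpotent:
  assumes ads: "\<And>u x y. g (br u x) y = g x (ads u y)"
    and tr_ad: "\<And>u. endo_trace (br u) = 0"
    and killing: "\<And>u v. endo_trace (\<lambda>w. br u (br v w)) = 0"
  shows "ricci br g u v =
    - 1/2 * endo_trace (\<lambda>w. br u (ads v w)) - 1/4 * endo_trace (\<lambda>w. ads (ads w v) u)"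
proof -
  let ?N = "levi_civita br g"
  have ads': "g (ads u y) x = g y (br u x)" for u x y
    using ads[of u x y] g_sym by metis
  have lads: "linear (ads u)" for u
    by (rule linearI; rule g_eqI) (simp_all add: g_simps ads')
  have lads2: "linear (\<lambda>w. ads w u)" for u
    by (rule linearI; rule g_eqI) (simp_all add: g_simps ads' br_simps)
  have lbr: "linear (br u)" for u
    using bilbr by (simp add: bilinear_def)
  note add = linear_add[OF lads] linear_add[OF lads2]
  have tr1: "(\<Sum>b\<in>B. g (br z b) b) = 0" for z
    using tr_ad endo_trace_orthonormal[OF lbr] by simp
  have tr2: "(\<Sum>b\<in>B. g (br x (br y b)) b) = 0" for x y
    using killing[of x y] endo_trace_orthonormal[OF linear_compose[OF lbr lbr], of x y]
    by (simp add: o_def)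
  have tr2': "(\<Sum>b\<in>B. g (ads x (ads y b)) b) = 0" for x y
  proof -
    have "g (ads x (ads y b)) b = g (br y (br x b)) b" for b
      by (metis ads' g_sym)
    then show ?thesis using tr2[of y x] by simp
  qed
  have nab: "?N w z = (- 1/2) *\<^sub>R (br z w + ads z w + ads w z)" for w z
  proof (rule g_eqI)
    fix y
    have "g (br w z) y = - g (br z w) y" "g (br y w) z = - g (br w y) z"
      using br_skew g_simps by metis+
    then show "g (?N w z) y = g ((- 1/2) *\<^sub>R (br z w + ads z w + ads w z)) y"
      using levi_civita_koszul[OF levi_civita, of w z y]
      by (simp add: g_simps ads' g_sym[of w] g_sym[of z] field_simps)
  qed
  have skew0: "g (?N z b) b = 0" for z b
    using levi_civita_metric[of z b b] by (simp add: g_sym)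
  have a: "(\<Sum>b\<in>B. g (?N b z) b) = 0" for z
  proof -
    have "g (?N b z) b = - g (br z b) b" for b
      using levi_civita_torsion[of z b] skew0[of z b] by (simp add: g_simps flip: levi_civita_torsion)
    then show ?thesis by (simp add: sum_negf tr1)
  qed
  have b: "(\<Sum>b\<in>B. g (?N u (?N b v)) b) = (\<Sum>b\<in>B. g (?N (?N u b) v) b)"
    using trace_commute[of "?N u" "\<lambda>w. ?N w v"] bilinear_levi_civita by (simp add: bilinear_def)
  have c: "?N b u = ?N u b + br b u" for b
    using levi_civita_torsion[of b u] by (simp add: algebra_simps)
  have "ricci br g u v = - (\<Sum>b\<in>B. g (?N (?N b u) v) b)"
    unfolding ricci_eq_sum curvature_def g_simps sum_subtractf a b c nabla_simps sum.distrib by simp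
  also have "\<dots> = - (1/4) * (\<Sum>b\<in>B. g ((br v (br u b + ads u b + ads b u)
      + ads v (br u b + ads u b + ads b u)) + ads (br u b + ads u b + ads b u) v) b)"
  proof -
    define Q where "Q z w = br z w + ads z w + ads w z" for z w
    have lQ: "linear (Q z)" for z
      unfolding Q_def by (intro linear_compose_add lbr lads lads2)
    have "?N (?N b u) v = (1/4) *\<^sub>R Q v (Q u b)" for b
      unfolding nab Q_def[symmetric] linear_scale[OF lQ] by simp
    then show ?thesis
      by (simp add: g_simps sum_distrib_left sum_negf flip: Q_def)
  qed
  also have "\<dots> = - (1/4) * (
      (\<Sum>b\<in>B. g (br v (ads u b)) b) + (\<Sum>b\<in>B. g (ads v (br u b)) b)
      + ((\<Sum>b\<in>B. g (br v (ads b u)) b) + (\<Sum>b\<in>B. g (ads v (ads b u)) b))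
      + ((\<Sum>b\<in>B. g (ads (br u b) v) b) + (\<Sum>b\<in>B. g (ads (ads u b) v) b))
      + (\<Sum>b\<in>B. g (ads (ads b u) v) b))"
    using tr2[of v u] tr2'[of v u]
    by (simp add: g_simps br_simps add sum.distrib)
  also have "(\<Sum>b\<in>B. g (ads v (br u b)) b) = (\<Sum>b\<in>B. g (br u (ads v b)) b)"
    by (rule trace_commute[OF lads lbr])
  also have "(\<Sum>b\<in>B. g (br v (ads u b)) b) = (\<Sum>b\<in>B. g (br u (ads v b)) b)"
  proof (rule sum.cong[OF refl])
    show "g (br v (ads u b)) b = g (br u (ads v b)) b" for b
      by (metis ads g_sym)
  qed
  also have "(\<Sum>b\<in>B. g (ads (ads b u) v) b) = (\<Sum>b\<in>B. g (ads (ads b v) u) b)"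
    by (rule trace_commute[OF lads2 lads2])
  also have "(\<Sum>b\<in>B. g (br v (ads b u)) b) + (\<Sum>b\<in>B. g (ads v (ads b u)) b) = 0"
  proof -
    have J: "g (ads x y) z = - g (ads z y) x" for x y z
      using ads'[of x y z] ads'[of z y x] br_skew[of x z] by (simp add: g_simps)
    have "(\<Sum>b\<in>B. g (br v (ads b u)) b) = (\<Sum>b\<in>B. g (ads b u) (ads v b))"
      by (simp add: ads)
    also have "\<dots> = - (\<Sum>b\<in>B. g (ads (ads v b) u) b)"
    proof -
      have "g (ads b u) (ads v b) = - g (ads (ads v b) u) b" for b
        by (rule J)
      then show ?thesis by (simp add: sum_negf)
    qed
    also have "(\<Sum>b\<in>B. g (ads (ads v b) u) b) = (\<Sum>b\<in>B. g (ads v (ads b u)) b)"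
      by (rule trace_commute[OF lads2 lads])
    finally show ?thesis by simp
  qed
  also have "(\<Sum>b\<in>B. g (ads (br u b) v) b) + (\<Sum>b\<in>B. g (ads (ads u b) v) b) = 0"
  proof -
    have J: "g (ads x y) z = - g (ads z y) x" for x y z
      using ads'[of x y z] ads'[of z y x] br_skew[of x z] by (simp add: g_simps)
    have "(\<Sum>b\<in>B. g (ads (br u b) v) b) = - (\<Sum>b\<in>B. g (br u b) (ads b v))"
    proof -
      have "g (ads (br u b) v) b = - g (br u b) (ads b v)" for b
        by (metis J g_sym)
      then show ?thesis by (simp add: sum_negf)
    qed
    also have "(\<Sum>b\<in>B. g (br u b) (ads b v)) = (\<Sum>b\<in>B. g (ads u (ads b v)) b)"
    proof (rule sum.cong[OF refl])
      show "g (br u b) (ads b v) = g (ads u (ads b v)) b" for b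
        by (metis ads g_sym)
    qed
    also have "\<dots> = (\<Sum>b\<in>B. g (ads (ads u b) v) b)"
      by (rule trace_commute[OF lads lads2])
    finally show ?thesis by simp
  qed
  finally have *: "ricci br g u v = - (1/4) * ((\<Sum>b\<in>B. g (br u (ads v b)) b)
      + (\<Sum>b\<in>B. g (br u (ads v b)) b) + 0 + 0 + (\<Sum>b\<in>B. g (ads (ads b v) u) b))" .
  show ?thesis
    using * endo_trace_orthonormal[OF linear_compose[OF lads[of v] lbr[of u]]]
      endo_trace_orthonormal[OF linear_compose[OF lads2[of v] lads2[of u]]]
    by (simp add:o_def field_simps)
qed

end

lemma is_A55I:
  assumes lie: "lie_bracket br" and v: "basis5 v"
    and tab: "A55_brackets br v \<alpha> \<beta> \<gamma> \<delta> \<epsilon>"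
    and nz: "\<alpha> \<noteq> 0" "\<gamma> \<noteq> 0" "\<epsilon> \<noteq> 0"
  shows "is_A55 br"
proof -
  have bil: "bilinear br" and self: "br x x = 0" for x
    using lie by (auto simp: lie_bracket_def)
  note br_simps = bilinear_ladd[OF bil] bilinear_radd[OF bil] bilinear_lsub[OF bil]
    bilinear_rsub[OF bil] bilinear_lmul[OF bil] bilinear_rmul[OF bil]
  have set5: "{1..5::nat} = {1,2,3,4,5}" by auto
  define xs where "xs = [v 1, v 1, v 2 - (\<delta> / \<gamma>) *\<^sub>R v 1, (\<alpha> * \<epsilon> / \<gamma>) *\<^sub>R v 3,
    \<alpha> *\<^sub>R v 4 + \<beta> *\<^sub>R v 5, (\<alpha> * \<epsilon>) *\<^sub>R v 5]"
  define x where "x = (!) xs"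
  have x: "x 1 = v 1" "x 2 = v 2 - (\<delta> / \<gamma>) *\<^sub>R v 1" "x 3 = (\<alpha> * \<epsilon> / \<gamma>) *\<^sub>R v 3"
    "x 4 = \<alpha> *\<^sub>R v 4 + \<beta> *\<^sub>R v 5" "x 5 = (\<alpha> * \<epsilon>) *\<^sub>R v 5"
    by (simp_all add: x_def xs_def numeral_eq_Suc)
  have "A55_brackets br x 1 0 1 0 1"
    using tab nz unfolding A55_brackets_def x by (simp add: br_simps self algebra_simps)
  moreover have "basis5 x"
  proof -
    let ?X = "x ` {1..5}"
    have mem: "x i \<in> span ?X" if "i \<in> {1..5}" for i
      using that by (intro span_base) auto
    have v1: "v 1 \<in> span ?X"
      using mem[of 1] unfolding x by simp
    have "v 2 = x 2 + (\<delta> / \<gamma>) *\<^sub>R v 1" by (simp add: x)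
    then have v2: "v 2 \<in> span ?X"
      using span_add[OF mem[of 2] span_scale[OF v1]] by simp
    have "v 3 = (\<gamma> / (\<alpha> * \<epsilon>)) *\<^sub>R x 3" using nz by (simp add: x)
    then have v3: "v 3 \<in> span ?X"
      using span_scale[OF mem[of 3]] by simp
    have "v 5 = (1 / (\<alpha> * \<epsilon>)) *\<^sub>R x 5" using nz by (simp add: x)
    then have v5: "v 5 \<in> span ?X"
      using span_scale[OF mem[of 5]] by simp
    have "v 4 = (1 / \<alpha>) *\<^sub>R (x 4 - \<beta> *\<^sub>R v 5)" using nz by (simp add: x)
    then have v4: "v 4 \<in> span ?X"
      using span_scale[OF span_diff[OF mem[of 4] span_scale[OF v5]]] by simp
    have "v ` {1..5} \<subseteq> span ?X"
      using v1 v2 v3 v4 v5 unfolding set5 by blast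
    then have span: "span ?X = UNIV"
      using v span_minimal[OF _ subspace_span] unfolding basis5_def by blast
    have "card (v ` {1..5}) = 5"
      using v by (simp add: basis5_def card_image)
    then have dim: "dim (UNIV::'a set) = 5"
      using v real_vector.dim_eq_card[of "v ` {1..5}" UNIV] by (simp add: basis5_def)
    obtain C where C: "C \<subseteq> ?X" "independent C" "?X \<subseteq> span C"
      using real_vector.maximal_independent_subset[of ?X] by blast
    have "span C = UNIV"
      using C(3) span span_minimal[OF _ subspace_span] by blast
    then have cC: "card C = 5"
      using dim real_vector.dim_eq_card[of C UNIV] C(2) by simp
    moreover have le: "card ?X \<le> 5"
      using card_image_le[of "{1..5::nat}" x] by simp
    ultimately have "C = ?X"
      using C(1) by (intro card_seteq) auto
    then show ?thesis
      using span C cC by (simp add: basis5_def eq_card_imp_inj_on)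
  qed
  ultimately show ?thesis using lie by (auto simp: is_A55_def)
qed

text \<open>The trace conditions of \<open>ricci_nilpotent\<close> hold for this algebra.\<close>

lemma A55_traces:
  assumes lie: "lie_bracket br" and v: "basis5 v"
    and tab: "A55_brackets br v \<alpha> \<beta> \<gamma> \<delta> \<epsilon>"
  shows "endo_trace (br x) = 0" and "endo_trace (\<lambda>w. br x (br y w)) = 0"
proof -
  have bil: "bilinear br" and self: "br x x = 0" for x
    using lie by (auto simp: lie_bracket_def)
  have skew: "br x y = - br y x" for x y
  proof -
    have "br (x + y) (x + y) = br x y + br y x"
      by (simp add: bilinear_ladd[OF bil] bilinear_radd[OF bil] self[of x] self[of y])
    then show ?thesis by (metis self eq_neg_iff_add_eq_0)
  qed
  have lbr: "linear (br u)" for u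
    using bil by (simp add: bilinear_def)
  have set5: "{1..5::nat} = {1,2,3,4,5}" by auto
  let ?V = "v ` {1..5}"
  have inj: "inj_on v {1..5}" and V: "finite ?V" "independent ?V" "span ?V = UNIV"
    using v by (auto simp: basis5_def)
  define k where "k i w = representation ?V w (v i)" for i w
  have tr: "endo_trace f = (\<Sum>i\<in>{1..5}. k i (f (v i)))" if "linear f" for f
    using endo_trace_basis[OF that V] inj by (simp add: sum.reindex k_def)
  have lk: "linear (k i)" for i
    using real_vector.linear_representation[OF V(2,3)]
    by (simp add: k_def[abs_def] linear_def real_scaleR_def[abs_def])
  have kv: "k i (v j) = (if i = j then 1 else 0)" if "i \<in> {1..5}" "j \<in> {1..5}" for i j
  proof -
    have "representation ?V (v j) = (\<lambda>w. if w = v j then 1 else 0)"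
      by (rule real_vector.representation_basis[OF V(2)]) (use that in blast)
    then show ?thesis using inj_onD[OF inj _ that] by (auto simp: k_def)
  qed
  have ex: "w = k 1 w *\<^sub>R v 1 + k 2 w *\<^sub>R v 2 + k 3 w *\<^sub>R v 3 + k 4 w *\<^sub>R v 4 + k 5 w *\<^sub>R v 5" for w
  proof -
    have "w = (\<Sum>b\<in>?V. representation ?V w b *\<^sub>R b)"
      by (rule real_vector.sum_representation_eq[symmetric]) (use V in auto)
    also have "\<dots> = (\<Sum>i\<in>{1..5}. k i w *\<^sub>R v i)"
      using inj by (simp add: sum.reindex k_def)
    also have "\<dots> = k 1 w *\<^sub>R v 1 + k 2 w *\<^sub>R v 2 + k 3 w *\<^sub>R v 3 + k 4 w *\<^sub>R v 4 + k 5 w *\<^sub>R v 5"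
      unfolding set5 by (simp add: add.assoc)
    finally show ?thesis .
  qed
  have br: "br u w = (\<alpha> * (k 1 u * k 2 w - k 2 u * k 1 w)) *\<^sub>R v 4 +
      (\<beta> * (k 1 u * k 2 w - k 2 u * k 1 w) + \<gamma> * (k 1 u * k 3 w - k 3 u * k 1 w)
       + \<delta> * (k 2 u * k 3 w - k 3 u * k 2 w) + \<epsilon> * (k 2 u * k 4 w - k 4 u * k 2 w)) *\<^sub>R v 5" for u w
  proof -
    note t = tab[unfolded A55_brackets_def]
    have s: "br (v 2) (v 1) = - br (v 1) (v 2)" "br (v 3) (v 1) = - br (v 1) (v 3)"
      "br (v 4) (v 1) = - br (v 1) (v 4)" "br (v 5) (v 1) = - br (v 1) (v 5)"
      "br (v 3) (v 2) = - br (v 2) (v 3)" "br (v 4) (v 2) = - br (v 2) (v 4)"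
      "br (v 5) (v 2) = - br (v 2) (v 5)" "br (v 4) (v 3) = - br (v 3) (v 4)"
      "br (v 5) (v 3) = - br (v 3) (v 5)" "br (v 5) (v 4) = - br (v 4) (v 5)"
      by (rule skew)+
    have "br u w = br
        (k 1 u *\<^sub>R v 1 + k 2 u *\<^sub>R v 2 + k 3 u *\<^sub>R v 3 + k 4 u *\<^sub>R v 4 + k 5 u *\<^sub>R v 5)
        (k 1 w *\<^sub>R v 1 + k 2 w *\<^sub>R v 2 + k 3 w *\<^sub>R v 3 + k 4 w *\<^sub>R v 4 + k 5 w *\<^sub>R v 5)"
      by (rule arg_cong2[where f = br, OF ex ex])
    also have "\<dots> = (\<alpha> * (k 1 u * k 2 w - k 2 u * k 1 w)) *\<^sub>R v 4 +
      (\<beta> * (k 1 u * k 2 w - k 2 u * k 1 w) + \<gamma> * (k 1 u * k 3 w - k 3 u * k 1 w)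
       + \<delta> * (k 2 u * k 3 w - k 3 u * k 2 w) + \<epsilon> * (k 2 u * k 4 w - k 4 u * k 2 w)) *\<^sub>R v 5"
      by (simp only: bilinear_ladd[OF bil] bilinear_radd[OF bil] bilinear_lmul[OF bil]
        bilinear_rmul[OF bil] s self t) (simp add: algebra_simps)
    finally show ?thesis .
  qed
  have k: "k i (br u w) = (\<alpha> * (k 1 u * k 2 w - k 2 u * k 1 w)) * k i (v 4) +
      (\<beta> * (k 1 u * k 2 w - k 2 u * k 1 w) + \<gamma> * (k 1 u * k 3 w - k 3 u * k 1 w)
       + \<delta> * (k 2 u * k 3 w - k 3 u * k 2 w) + \<epsilon> * (k 2 u * k 4 w - k 4 u * k 2 w)) * k i (v 5)" for i u w
    unfolding br[of u w] linear_add[OF lk] linear_scale[OF lk] by simp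
  show "endo_trace (br x) = 0"
    unfolding tr[OF lbr] set5 k by (simp add: kv)
  show "endo_trace (\<lambda>w. br x (br y w)) = 0"
    unfolding tr[OF linear_compose[OF lbr lbr, unfolded o_def]] set5 k by (simp add: kv)
qed

end

theory Submission
  imports Defs
begin

text \<open>Rescaling the basis by \<open>sqrt \<eta>\<close> makes it orthonormal and multiplies all five structure
  constants by \<open>sqrt \<eta>\<close>, so one may take \<open>\<eta> = 1\<close>. The Ricci tensor is then an explicit quadratic
  expression in the structure constants, and the metric is Schouten like iff \<open>Ric - k id\<close> is a
  derivation for some real \<open>k\<close>. Applied to \<open>[v\<^sub>1, v\<^sub>3]\<close> (component \<open>v\<^sub>4\<close>) and to \<open>[v\<^sub>1, v\<^sub>4]\<close>
  (component \<open>v\<^sub>5\<close>) the derivation rule forces \<open>\<beta> = 0\<close> and \<open>\<delta> = 0\<close>. The operator is then diagonal,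
  and the rule on \<open>[v\<^sub>1, v\<^sub>2]\<close>, \<open>[v\<^sub>1, v\<^sub>3]\<close>, \<open>[v\<^sub>2, v\<^sub>4]\<close> gives three linear equations in \<open>k\<close>,
  \<open>\<alpha>\<^sup>2\<close>, \<open>\<gamma>\<^sup>2\<close>, \<open>\<epsilon>\<^sup>2\<close>, which are equivalent to \<open>\<alpha>\<^sup>2 = \<epsilon>\<^sup>2 = 2 \<gamma>\<^sup>2\<close> and \<open>2 k = - 7 \<gamma>\<^sup>2\<close>.\<close>

context metric_lie_algebra
begin

lemma parseval: "g x y = (\<Sum>b\<in>B. g x b * g y b)"
  using g_sum_left[of "\<lambda>b. g x b *\<^sub>R b" B y] by (simp add: expandB g_simps g_sym[of y])

text \<open>Expanding both traces in the orthonormal basis and moving each transpose back onto a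
  bracket leaves only structure constants.\<close>

lemma ricci_nilpotent_sum:
  assumes tr_ad: "\<And>u. endo_trace (br u) = 0"
    and killing: "\<And>u w. endo_trace (\<lambda>x. br u (br w x)) = 0"
  shows "ricci br g u w = - 1/2 * (\<Sum>b\<in>B. g (br u b) (br w b))
    + 1/4 * (\<Sum>b\<in>B. \<Sum>c\<in>B. g (br b c) u * g (br b c) w)"
proof -
  define ads where "ads u y = (\<Sum>b\<in>B. g (br u b) y *\<^sub>R b)" for u y
  have lin: "linear (\<lambda>x. g (br u x) y)" for u y
    by (rule linearI) (simp_all add: g_simps br_simps)
  have adj: "g (ads u y) x = g (br u x) y" for u x y
    unfolding ads_def by (rule riesz[OF lin])
  have adj': "g (br u x) y = g x (ads u y)" for u x y
    by (simp add: adj flip: g_sym[of "ads u y"])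
  have lads: "linear (ads u)" and lJ: "linear (\<lambda>x. ads x u)" and lbr: "linear (br u)" for u
    by (rule linearI; (rule g_eqI)?; simp add: adj g_simps br_simps)+
  have 1: "endo_trace (\<lambda>x. br u (ads w x)) = (\<Sum>b\<in>B. g (br u b) (br w b))"
  proof -
    have "endo_trace (\<lambda>x. br u (ads w x)) = (\<Sum>b\<in>B. g (ads w (br u b)) b)"
      using endo_trace_orthonormal[OF linear_compose[OF lads[of w] lbr[of u]]]
        trace_commute[OF lbr[of u] lads[of w]] by (simp add: o_def)
    then show ?thesis unfolding adj by (simp add: g_sym)
  qed
  have 2: "endo_trace (\<lambda>x. ads (ads x w) u) = - (\<Sum>b\<in>B. \<Sum>c\<in>B. g (br b c) u * g (br b c) w)"
  proof -
    have "g (ads (ads b w) u) b = - (\<Sum>c\<in>B. g (br b c) u * g (br b c) w)" for b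
    proof -
      \<comment> \<open>\<open>J\<close> is skew: the adjoint turns the left side into a bracket
        whose arguments are then swapped.\<close>
      have "g (ads (ads b w) u) b = - g (ads b u) (ads b w)"
        using br_skew[of "ads b w" b] by (simp add: adj g_simps)
      then show ?thesis unfolding parseval[of "ads b u" "ads b w"] unfolding adj .
    qed
    then show ?thesis
      using endo_trace_orthonormal[OF linear_compose[OF lJ[of w] lJ[of u]]]
      by (simp add: o_def sum_negf)
  qed
  show ?thesis
    unfolding ricci_nilpotent[OF adj' tr_ad killing] 1 2 by simp
qed

end

lemma schouten_like_orthonormal_A55:
  assumes lie: "lie_bracket br" and ip: "inner_product g" and e: "basis5 e"
    and ortho: "\<And>i j. i \<in> {1..5} \<Longrightarrow> j \<in> {1..5} \<Longrightarrow> g (e i) (e j) = (if i = j then 1 else 0)"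
    and tab: "A55_brackets br e \<alpha> \<beta> \<gamma> \<delta> \<epsilon>"
    and pos: "\<alpha> > 0" "\<gamma> > 0" "\<epsilon> > 0"
  shows "schouten_like br g \<longleftrightarrow> \<beta> = 0 \<and> \<delta> = 0 \<and> \<alpha> = \<epsilon> \<and> \<epsilon> = sqrt 2 * \<gamma>"
proof -
  have inj: "inj_on e {1..5}" and spanB: "span (e ` {1..5}) = UNIV"
    using e by (auto simp: basis5_def)
  interpret metric_lie_algebra br g "e ` {1..5}"
    by unfold_locales (use lie ip spanB ortho inj in \<open>auto simp: inj_on_eq_iff\<close>)
  have set5: "{1..5::nat} = {1,2,3,4,5}" by auto
  have sum5: "(\<Sum>b\<in>e ` {1..5}. f b) = f (e 1) + f (e 2) + f (e 3) + f (e 4) + f (e 5)"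
    for f :: "'a \<Rightarrow> 'b::comm_monoid_add"
    unfolding sum.reindex[OF inj] unfolding set5 by (simp add: add.assoc)
  have expand: "x = g x (e 1) *\<^sub>R e 1 + g x (e 2) *\<^sub>R e 2 + g x (e 3) *\<^sub>R e 3
      + g x (e 4) *\<^sub>R e 4 + g x (e 5) *\<^sub>R e 5" for x
    using expandB[of x] unfolding sum5 by simp
  have br: "br u w = (\<alpha> * (g u (e 1) * g w (e 2) - g u (e 2) * g w (e 1))) *\<^sub>R e 4
      + (\<beta> * (g u (e 1) * g w (e 2) - g u (e 2) * g w (e 1))
       + \<gamma> * (g u (e 1) * g w (e 3) - g u (e 3) * g w (e 1))
       + \<delta> * (g u (e 2) * g w (e 3) - g u (e 3) * g w (e 2))
       + \<epsilon> * (g u (e 2) * g w (e 4) - g u (e 4) * g w (e 2))) *\<^sub>R e 5" for u w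
  proof -
    have skew: "br (e 2) (e 1) = - br (e 1) (e 2)" "br (e 3) (e 1) = - br (e 1) (e 3)"
      "br (e 4) (e 1) = - br (e 1) (e 4)" "br (e 5) (e 1) = - br (e 1) (e 5)"
      "br (e 3) (e 2) = - br (e 2) (e 3)" "br (e 4) (e 2) = - br (e 2) (e 4)"
      "br (e 5) (e 2) = - br (e 2) (e 5)" "br (e 4) (e 3) = - br (e 3) (e 4)"
      "br (e 5) (e 3) = - br (e 3) (e 5)" "br (e 5) (e 4) = - br (e 4) (e 5)"
      by (rule br_skew)+
    show ?thesis
      by (subst expand[of u], subst expand[of w])
         (simp only: br_simps skew br_self tab[unfolded A55_brackets_def], simp add: algebra_simps)
  qed
  have gbr: "g (br u w) z = \<alpha> * (g u (e 1) * g w (e 2) - g u (e 2) * g w (e 1)) * g z (e 4)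
      + (\<beta> * (g u (e 1) * g w (e 2) - g u (e 2) * g w (e 1))
       + \<gamma> * (g u (e 1) * g w (e 3) - g u (e 3) * g w (e 1))
       + \<delta> * (g u (e 2) * g w (e 3) - g u (e 3) * g w (e 2))
       + \<epsilon> * (g u (e 2) * g w (e 4) - g u (e 4) * g w (e 2))) * g z (e 5)" for u w z
    unfolding br[of u w] g_simps by (simp add: g_sym)
  have gee: "g (e 1) (e 1) = 1" "g (e 1) (e 2) = 0" "g (e 1) (e 3) = 0" "g (e 1) (e 4) = 0" "g (e 1) (e 5) = 0"
    "g (e 2) (e 1) = 0" "g (e 2) (e 2) = 1" "g (e 2) (e 3) = 0" "g (e 2) (e 4) = 0" "g (e 2) (e 5) = 0"
    "g (e 3) (e 1) = 0" "g (e 3) (e 2) = 0" "g (e 3) (e 3) = 1" "g (e 3) (e 4) = 0" "g (e 3) (e 5) = 0"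
    "g (e 4) (e 1) = 0" "g (e 4) (e 2) = 0" "g (e 4) (e 3) = 0" "g (e 4) (e 4) = 1" "g (e 4) (e 5) = 0"
    "g (e 5) (e 1) = 0" "g (e 5) (e 2) = 0" "g (e 5) (e 3) = 0" "g (e 5) (e 4) = 0" "g (e 5) (e 5) = 1"
    by (subst ortho; simp)+
  \<comment> \<open>Nilpotency enters here, through the vanishing traces of
    \<open>A55_traces\<close>.\<close>
  have ric0: "ricci br g u w = - 1/2 * (\<Sum>b\<in>e ` {1..5}. g (br u b) (br w b))
    + 1/4 * (\<Sum>b\<in>e ` {1..5}. \<Sum>c\<in>e ` {1..5}. g (br b c) u * g (br b c) w)" for u w
    by (rule ricci_nilpotent_sum) (rule A55_traces[OF lie e tab])+
  \<comment> \<open>Every mixed coefficient contains \<beta> or \<delta>, so the form is diagonal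
    once both vanish.\<close>
  have ric: "ricci br g u w = - 1/2 *
      (let x = g u; y = g w in (\<alpha>\<^sup>2 + \<beta>\<^sup>2 + \<gamma>\<^sup>2) * x (e 1) * y (e 1)
       + (\<alpha>\<^sup>2 + \<beta>\<^sup>2 + \<delta>\<^sup>2 + \<epsilon>\<^sup>2) * x (e 2) * y (e 2) + (\<gamma>\<^sup>2 + \<delta>\<^sup>2) * x (e 3) * y (e 3)
       + (\<epsilon>\<^sup>2 - \<alpha>\<^sup>2) * x (e 4) * y (e 4) - (\<beta>\<^sup>2 + \<gamma>\<^sup>2 + \<delta>\<^sup>2 + \<epsilon>\<^sup>2) * x (e 5) * y (e 5)
       + \<gamma> * \<delta> * (x (e 1) * y (e 2) + x (e 2) * y (e 1))
       - \<beta> * \<delta> * (x (e 1) * y (e 3) + x (e 3) * y (e 1))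
       - \<beta> * \<epsilon> * (x (e 1) * y (e 4) + x (e 4) * y (e 1))
       + \<beta> * \<gamma> * (x (e 2) * y (e 3) + x (e 3) * y (e 2))
       + \<delta> * \<epsilon> * (x (e 3) * y (e 4) + x (e 4) * y (e 3))
       - \<alpha> * \<beta> * (x (e 4) * y (e 5) + x (e 5) * y (e 4)))" for u w
    unfolding ric0 sum5 gbr gee Let_def by (simp add: field_simps power2_eq_square)
  show ?thesis
  proof
    assume "schouten_like br g"
    \<comment> \<open>\<open>k\<close> stands for \<open>scalar_curvature br g * l0 + c\<close>; the
      value of the scalar curvature never matters, since \<open>c\<close> is free.\<close>
    then obtain k D where D: "lie_derivation br D"
      and eq: "\<And>x y. ricci br g x y = k * g x y + g (D x) y"
      unfolding schouten_like_def by blast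
    have gD: "g (D x) y = ricci br g x y - k * g x y" for x y
      using eq[of x y] by simp
    have der: "ricci br g (br x y) z - k * g (br x y) z = g (br (D x) y) z + g (br x (D y)) z" for x y z
      using D by (simp add: g_simps flip: gD) (simp add: lie_derivation_def g_simps)
    note coords = gD gbr ric gee Let_def
    \<comment> \<open>The left side of \<open>der\<close> is
      \<open>\<alpha> * \<beta> * \<gamma> / 2\<close>, the right side its negative.\<close>
    have "\<alpha> * \<beta> * \<gamma> = 0"
      using der[of "e 1" "e 3" "e 4"] unfolding coords by (simp add: field_simps)
    then have b: "\<beta> = 0" using pos by simp
    \<comment> \<open>Here the bracket vanishes, while both terms on the right equal
      \<open>- \<gamma> * \<delta> * \<epsilon> / 2\<close>.\<close>
    have "\<gamma> * \<delta> * \<epsilon> = 0"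
      using der[of "e 1" "e 4" "e 5"] unfolding coords by (simp add: field_simps)
    then have d: "\<delta> = 0" using pos by simp
    \<comment> \<open>Now \<open>D\<close> is diagonal with eigenvalues \<open>d i\<close>, and each
      bracket \<open>[e i, e j] = c e m\<close> gives
      \<open>c * (d m - d i - d j) = 0\<close>.\<close>
    have "\<alpha> * (2 * k + 3 * \<alpha>\<^sup>2 + \<gamma>\<^sup>2) = 0"
      using der[of "e 1" "e 2" "e 4"] unfolding coords b d
      by (simp add: field_simps power2_eq_square)
    moreover have "\<gamma> * (2 * k + \<alpha>\<^sup>2 + 3 * \<gamma>\<^sup>2 + \<epsilon>\<^sup>2) = 0"
      using der[of "e 1" "e 3" "e 5"] unfolding coords b d
      by (simp add: field_simps power2_eq_square)
    moreover have "\<epsilon> * (2 * k + \<gamma>\<^sup>2 + 3 * \<epsilon>\<^sup>2) = 0"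
      using der[of "e 2" "e 4" "e 5"] unfolding coords b d
      by (simp add: field_simps power2_eq_square)
    ultimately have "2 * k + 3 * \<alpha>\<^sup>2 + \<gamma>\<^sup>2 = 0" "2 * k + \<alpha>\<^sup>2 + 3 * \<gamma>\<^sup>2 + \<epsilon>\<^sup>2 = 0"
      "2 * k + \<gamma>\<^sup>2 + 3 * \<epsilon>\<^sup>2 = 0"
      using pos by simp_all
    \<comment> \<open>The first and third equations give the first equality; subtracting the second
      from the first then gives the other.\<close>
    then have "\<alpha>\<^sup>2 = \<epsilon>\<^sup>2" "\<epsilon>\<^sup>2 = (sqrt 2 * \<gamma>)\<^sup>2"
      unfolding power_mult_distrib real_sqrt_pow2[OF zero_le_numeral] by linarith+
    then show "\<beta> = 0 \<and> \<delta> = 0 \<and> \<alpha> = \<epsilon> \<and> \<epsilon> = sqrt 2 * \<gamma>"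
      using b d pos by (simp add: power2_eq_iff_nonneg)
  next
    assume *: "\<beta> = 0 \<and> \<delta> = 0 \<and> \<alpha> = \<epsilon> \<and> \<epsilon> = sqrt 2 * \<gamma>"
    then have b: "\<beta> = 0" and d: "\<delta> = 0" and a: "\<alpha> = \<epsilon>" and e2: "\<epsilon>\<^sup>2 = 2 * \<gamma>\<^sup>2"
      by (simp_all add: power_mult_distrib)
    \<comment> \<open>The shift is \<open>- k\<close>, with \<open>k\<close> forced by
      \<open>2 * k + 3 * \<alpha>\<^sup>2 + \<gamma>\<^sup>2 = 0\<close> at
      \<open>\<alpha>\<^sup>2 = 2 * \<gamma>\<^sup>2\<close>.\<close>
    define D where "D x = ricci_operator br g x + (7/2 * \<gamma>\<^sup>2) *\<^sub>R x" for x
    \<comment> \<open>The eigenvalues are proportional to 4, 3, 6, 7, 10, and 4 + 3 = 7, 4 + 6 = 10,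
      3 + 7 = 10 match the three remaining brackets: \<open>D\<close> is a derivation.\<close>
    have gD: "g (D x) y = \<gamma>\<^sup>2 / 2 * (4 * g x (e 1) * g y (e 1) + 3 * g x (e 2) * g y (e 2)
        + 6 * g x (e 3) * g y (e 3) + 7 * g x (e 4) * g y (e 4) + 10 * g x (e 5) * g y (e 5))" for x y
    proof -
      have "g (D x) y = ricci br g x y + 7/2 * \<gamma>\<^sup>2 * (\<Sum>b\<in>e ` {1..5}. g x b * g y b)"
        unfolding D_def parseval[symmetric] by (simp add: g_simps ricci_operator)
      then show ?thesis
        unfolding ric sum5 b d a e2 Let_def by (simp add: algebra_simps)
    qed
    have "linear D"
      by (rule linearI; rule g_eqI) (simp_all add: gD g_simps algebra_simps)
    moreover have "D (br x y) = br (D x) y + br x (D y)" for x y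
      by (rule g_eqI) (simp only: g_simps gD gbr gee b d a, simp add: algebra_simps)
    moreover have "g (D x) y = g x (D y)" for x y
      by (simp only: g_sym[of x "D y"] gD) (simp add: algebra_simps)
    moreover have "ricci br g x y = (scalar_curvature br g * 0 + (- 7/2 * \<gamma>\<^sup>2)) * g x y + g (D x) y" for x y
      by (simp add: D_def g_simps ricci_operator)
    ultimately show "schouten_like br g"
      unfolding schouten_like_def lie_derivation_def by blast
  qed
qed

theorem proposition8:
  fixes br :: "'a::real_vector \<Rightarrow> 'a \<Rightarrow> 'a"
    and g :: "'a \<Rightarrow> 'a \<Rightarrow> real"
    and v :: "nat \<Rightarrow> 'a"
    and \<eta> \<alpha> \<beta> \<gamma> \<delta> \<epsilon> :: real
  assumes "is_A55 br"
    and "inner_product g"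
    and "\<eta> > 0"
    and "basis5 v"
    and "\<forall>i\<in>{1..5}. \<forall>j\<in>{1..5}. \<eta> * g (v i) (v j) = (if i = j then 1 else 0)"
    and "A55_brackets br v \<alpha> \<beta> \<gamma> \<delta> \<epsilon>"
    and "\<alpha> > 0" and "\<gamma> > 0" and "\<epsilon> > 0"
  shows "schouten_like br g \<longleftrightarrow> \<beta> = 0 \<and> \<delta> = 0 \<and> \<alpha> = \<epsilon> \<and> \<epsilon> = sqrt 2 * \<gamma>"
proof -
  define s where "s = sqrt \<eta>"
  have s: "s > 0" "s * s = \<eta>"
    using assms(3) by (auto simp: s_def)
  define e where "e i = s *\<^sub>R v i" for i
  have lie: "lie_bracket br" using assms(1) by (simp add: is_A55_def)
  then have bil: "bilinear br" by (simp add: lie_bracket_def)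
  have bilg: "bilinear g" using assms(2) by (simp add: inner_product_def)
  have e_image: "e ` {1..5} = (\<lambda>x. s *\<^sub>R x) ` v ` {1..5}"
    by (simp add: e_def image_image)
  have "basis5 e"
    unfolding basis5_def
  proof (intro conjI)
    show "inj_on e {1..5}"
      using assms(4) s by (auto simp: basis5_def e_def inj_on_def)
    show "independent (e ` {1..5})"
      unfolding e_image
      by (rule linear_independent_injective_image)
        (use assms(4) s in \<open>auto simp: basis5_def inj_on_def intro!: linear_scale_self\<close>)
    show "span (e ` {1..5}) = UNIV"
      unfolding e_image using assms(4) s
      by (subst span_image_scale) (auto simp: basis5_def)
  qed
  moreover have "g (e i) (e j) = (if i = j then 1 else 0)" if "i \<in> {1..5}" "j \<in> {1..5}" for i j
    using assms(5) that s
    by (simp add: e_def bilinear_lmul[OF bilg] bilinear_rmul[OF bilg] flip: mult.assoc)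
  \<comment> \<open>Each bracket gains \<open>s * s\<close>, its value in the new basis absorbs one
    \<open>s\<close>, and one stays in the constants.\<close>
  moreover have "A55_brackets br e (s * \<alpha>) (s * \<beta>) (s * \<gamma>) (s * \<delta>) (s * \<epsilon>)"
    using assms(6) unfolding A55_brackets_def e_def
    by (simp add: bilinear_lmul[OF bil] bilinear_rmul[OF bil] algebra_simps)
  ultimately have "schouten_like br g \<longleftrightarrow> s * \<beta> = 0 \<and> s * \<delta> = 0 \<and> s * \<alpha> = s * \<epsilon> \<and> s * \<epsilon> = sqrt 2 * (s * \<gamma>)"
    by (rule schouten_like_orthonormal_A55[OF lie assms(2)]) (use assms(7-9) s in auto)
  \<comment> \<open>All the conditions are homogeneous in the structure constants, so
    \<open>s > 0\<close> cancels.\<close>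
  then show ?thesis using s by auto
qed

end
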